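(* Let $n\ge2$, $j\ge1$, $j\not\equiv0\pmod n$. Let $\gamma$ be a solution of the $j$-th central affine curve flow $\gamma_t=gZ_{j,0}(u)e_1$ on $\mathcal{M}_n(\mathbb{R})$, and let $u(\cdot,t)=\sum_{i=1}^{n-1}u_i(\cdot,t)e_{in}$ be the central affine curvature of $\gamma(\cdot,t)$. Then $u$ is a solution of the $j$-th $A^{(1)}_{n-1}$-KdV flow $u_t=[\partial_x+b+u,Z_{j,0}(u)]$.
   Context: $\mathcal{M}_n(\mathbb{R})$ is the set of smooth $\gamma:\mathbb{R}\to\mathbb{R}^n\setminus\{0\}$ with $\det(\gamma,\gamma_x,\ldots,\gamma_x^{(n-1)})=1$. For such $\gamma$ the central affine moving frame $g=(\gamma,\ldots,\gamma_x^{(n-1)})$ satisfies $g_x=g(b+u)$ with $b=\sum_{i=1}^{n-1}e_{i+1,i}$ and $u=\sum_{i=1}^{n-1}u_ie_{in}$, where $\gamma_x^{(n)}=u_1\gamma+\cdots+u_{n-1}\gamma_x^{(n-2)}$; $u$ is the central affine curvature. $V_n=\bigoplus_{i=1}^{n-1}\mathbb{R}e_{in}$, $e_1=(1,0,\ldots,0)^t$. A solution of the $j$-th central affine curve flow is a smooth $\gamma(x,t)$ on $\mathbb{R}^2$ with $\gamma(\cdot,t)\in\mathcal{M}_n(\mathbb{R})$ and $\gamma_t=gZ_{j,0}(u)e_1$, with $g(\cdot,t)$, $u(\cdot,t)$ the moving frame and curvature of $\gamma(\cdot,t)$. Let $J=e_{1n}\lambda+b$. For smooth $V_n$-valued $u$,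 let $Y(u,\lambda)=e_{1n}\lambda+\sum_{i\le 0}Y_{1,i}(u)\lambda^i$ be the unique formal series with smooth $sl(n)$-valued coefficients satisfying $Y_x+[J+u,Y]=0$ and $Y^n=\lambda I_n$; its coefficients are differential polynomials in $u$ (in the variable $x$). Write $Y(u,\lambda)^j=\sum_i Y_{j,i}(u)\lambda^i$. There is a unique strictly upper triangular $\zeta_j(u)$ (entries differential polynomials in $u$) with $[\partial_x+b+u,\,Y_{j,0}(u)-\zeta_j(u)]\in V_n$, where $[\partial_x+A,B]=B_x+[A,B]$. Set $Z_{j,0}(u)=Y_{j,0}(u)-\zeta_j(u)$. *)

theory Defs
  imports
    "HOL-Analysis.Derivative"
    "HOL-Computational_Algebra.Formal_Laurent_Series"
    "Jordan_Normal_Form.Determinant"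
begin

no_notation fls_nth (infixl \<open>$$\<close> 75)

text \<open>
  Matrices and vectors are those of Jordan_Normal_Form, so rows and columns are numbered
  from \<open>0\<close>: the matrix unit \<open>e\<^bsub>ik\<^esub>\<close> of the text is \<open>mat_unit n (i - 1) (k - 1)\<close>.
\<close>

section \<open>Smoothness and entrywise derivatives\<close>

text \<open>
  A function is of class \<open>C\<^sup>k\<^sup>+\<^sup>1\<close> iff it is differentiable and all its first-order partial
  derivatives are of class \<open>C\<^sup>k\<close>. This is used on \<open>real\<close> and on \<open>real \<times> real\<close>.
\<close>

primrec class_C :: "nat \<Rightarrow> ('a::euclidean_space \<Rightarrow> real) \<Rightarrow> bool" where
  "class_C 0 f \<longleftrightarrow> continuous_on UNIV f"
| "class_C (Suc k) f \<longleftrightarrow> (\<forall>p. f differentiable (at p)) \<and>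
     (\<forall>e\<in>Basis. class_C k (\<lambda>p. frechet_derivative f (at p) e))"

definition smooth :: "('a::euclidean_space \<Rightarrow> real) \<Rightarrow> bool" where
  "smooth f \<longleftrightarrow> (\<forall>k. class_C k f)"

definition smooth_vec :: "nat \<Rightarrow> ('a::euclidean_space \<Rightarrow> real vec) \<Rightarrow> bool" where
  "smooth_vec n v \<longleftrightarrow> (\<forall>p. v p \<in> carrier_vec n) \<and> (\<forall>i<n. smooth (\<lambda>p. v p $ i))"

definition smooth_mat :: "nat \<Rightarrow> ('a::euclidean_space \<Rightarrow> real mat) \<Rightarrow> bool" where
  "smooth_mat n A \<longleftrightarrow> (\<forall>p. A p \<in> carrier_mat n n) \<and>
     (\<forall>i<n. \<forall>k<n. smooth (\<lambda>p. A p $$ (i, k)))"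

definition vec_deriv :: "(real \<Rightarrow> real vec) \<Rightarrow> real \<Rightarrow> real vec" where
  "vec_deriv v x = vec (dim_vec (v x)) (\<lambda>i. deriv (\<lambda>s. v s $ i) x)"

definition mat_deriv :: "(real \<Rightarrow> real mat) \<Rightarrow> real \<Rightarrow> real mat" where
  "mat_deriv A x = mat (dim_row (A x)) (dim_col (A x)) (\<lambda>(i, k). deriv (\<lambda>s. A s $$ (i, k)) x)"

section \<open>Matrices\<close>

definition mat_unit :: "nat \<Rightarrow> nat \<Rightarrow> nat \<Rightarrow> real mat" where
  "mat_unit n i k = mat n n (\<lambda>(p, q). if p = i \<and> q = k then 1 else 0)"

definition b_mat :: "nat \<Rightarrow> real mat" where
  "b_mat n = mat n n (\<lambda>(p, q). if p = Suc q then 1 else 0)"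

definition V :: "nat \<Rightarrow> real mat set" where
  "V n = {A \<in> carrier_mat n n. \<forall>p<n. \<forall>q<n. \<not> (p < n - 1 \<and> q = n - 1) \<longrightarrow> A $$ (p, q) = 0}"

definition sl :: "nat \<Rightarrow> real mat set" where
  "sl n = {A \<in> carrier_mat n n. (\<Sum>i<n. A $$ (i, i)) = 0}"

definition strictly_upper_triangular :: "real mat \<Rightarrow> bool" where
  "strictly_upper_triangular A \<longleftrightarrow> (\<forall>i < dim_row A. \<forall>k < dim_col A. k \<le> i \<longrightarrow> A $$ (i, k) = 0)"

definition commutator :: "'a::ring mat \<Rightarrow> 'a mat \<Rightarrow> 'a mat" where
  "commutator A B = A * B - B * A"

text \<open>\<open>conn A B\<close> is \<open>[\<partial>\<^sub>x + A, B]\<close>.\<close>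

definition conn :: "(real \<Rightarrow> real mat) \<Rightarrow> (real \<Rightarrow> real mat) \<Rightarrow> real \<Rightarrow> real mat" where
  "conn A B x = mat_deriv B x + commutator (A x) (B x)"

section \<open>Central affine curves\<close>

text \<open>The columns of \<open>frame n \<gamma> x\<close> are \<open>\<gamma>, \<gamma>\<^sub>x, \<dots>, \<gamma>\<^sub>x\<^bsup>(n-1)\<^esup>\<close> at \<open>x\<close>.\<close>

definition frame :: "nat \<Rightarrow> (real \<Rightarrow> real vec) \<Rightarrow> real \<Rightarrow> real mat" where
  "frame n \<gamma> x = mat n n (\<lambda>(i, k). (vec_deriv ^^ k) \<gamma> x $ i)"

definition central_affine_curves :: "nat \<Rightarrow> (real \<Rightarrow> real vec) set" where
  "central_affine_curves n = {\<gamma>. smooth_vec n \<gamma> \<and> (\<forall>x. \<gamma> x \<noteq> 0\<^sub>v n) \<and> (\<forall>x. det (frame n \<gamma> x) = 1)}"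

definition is_curvature :: "nat \<Rightarrow> (real \<Rightarrow> real vec) \<Rightarrow> (real \<Rightarrow> real mat) \<Rightarrow> bool" where
  "is_curvature n \<gamma> u \<longleftrightarrow> (\<forall>x. u x \<in> V n) \<and>
     (\<forall>x. \<forall>k<n. (vec_deriv ^^ n) \<gamma> x $ k =
        (\<Sum>i<n - 1. u x $$ (i, n - 1) * ((vec_deriv ^^ i) \<gamma> x $ k)))"

section \<open>The series \<open>Y(u, \<lambda>)\<close> and the matrices \<open>Z\<^bsub>j,0\<^esub>(u)\<close>\<close>

text \<open>
  A formal series in \<open>\<lambda>\<close> with finitely many positive powers is a formal Laurent series in
  \<open>\<lambda>\<^sup>-\<^sup>1\<close>. So \<open>fls_X\<close> stands for \<open>\<lambda>\<^sup>-\<^sup>1\<close>, and the coefficient of \<open>\<lambda>\<^sup>i\<close> has index \<open>- i\<close>.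
\<close>

abbreviation lam :: "real fls" where
  "lam \<equiv> fls_X_inv"

definition lam_coeff :: "int \<Rightarrow> real fls mat \<Rightarrow> real mat" where
  "lam_coeff i A = map_mat (\<lambda>f. fls_nth f (- i)) A"

abbreviation const_series :: "real mat \<Rightarrow> real fls mat" where
  "const_series \<equiv> map_mat fls_const"

definition J :: "nat \<Rightarrow> real fls mat" where
  "J n = lam \<cdot>\<^sub>m const_series (mat_unit n 0 (n - 1)) + const_series (b_mat n)"

text \<open>The equation \<open>Y\<^sub>x + [J + u, Y] = 0\<close> is imposed on each coefficient of \<open>\<lambda>\<^sup>i\<close>.\<close>

definition is_Y :: "nat \<Rightarrow> (real \<Rightarrow> real mat) \<Rightarrow> (real \<Rightarrow> real fls mat) \<Rightarrow> bool" where
  "is_Y n u Y \<longleftrightarrow>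
     (\<forall>x. Y x \<in> carrier_mat n n) \<and>
     (\<forall>i. smooth_mat n (\<lambda>x. lam_coeff i (Y x)) \<and> (\<forall>x. lam_coeff i (Y x) \<in> sl n)) \<and>
     (\<forall>x. lam_coeff 1 (Y x) = mat_unit n 0 (n - 1)) \<and>
     (\<forall>i>1. \<forall>x. lam_coeff i (Y x) = 0\<^sub>m n n) \<and>
     (\<forall>i x. mat_deriv (\<lambda>s. lam_coeff i (Y s)) x
        + lam_coeff i (commutator (J n + const_series (u x)) (Y x)) = 0\<^sub>m n n) \<and>
     (\<forall>x. Y x ^\<^sub>m n = lam \<cdot>\<^sub>m 1\<^sub>m n)"

text \<open>
  For a smooth \<open>V n\<close>-valued \<open>u\<close>, the series \<open>Y(u, \<lambda>)\<close> and the matrix function \<open>\<zeta>\<^sub>j(u)\<close> exist and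
  are unique, so \<open>is_Z0 n j u\<close> holds of exactly one function, namely \<open>Z\<^bsub>j,0\<^esub>(u)\<close>.
\<close>

definition is_Z0 :: "nat \<Rightarrow> nat \<Rightarrow> (real \<Rightarrow> real mat) \<Rightarrow> (real \<Rightarrow> real mat) \<Rightarrow> bool" where
  "is_Z0 n j u Z \<longleftrightarrow> (\<exists>Y \<zeta>. is_Y n u Y \<and>
     smooth_mat n \<zeta> \<and> (\<forall>x. strictly_upper_triangular (\<zeta> x)) \<and>
     Z = (\<lambda>x. lam_coeff 0 (Y x ^\<^sub>m j) - \<zeta> x) \<and>
     (\<forall>x. conn (\<lambda>s. b_mat n + u s) Z x \<in> V n))"

section \<open>The flows\<close>

definition curve_flow_solution :: "nat \<Rightarrow> nat \<Rightarrow> (real \<Rightarrow> real \<Rightarrow> real vec) \<Rightarrow> bool" where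
  "curve_flow_solution n j \<gamma> \<longleftrightarrow>
     smooth_vec n (\<lambda>(x, t). \<gamma> x t) \<and>
     (\<forall>t. (\<lambda>x. \<gamma> x t) \<in> central_affine_curves n) \<and>
     (\<forall>t. \<exists>u Z. is_curvature n (\<lambda>x. \<gamma> x t) u \<and> is_Z0 n j u Z \<and>
        (\<forall>x. vec_deriv (\<lambda>s. \<gamma> x s) t = frame n (\<lambda>y. \<gamma> y t) x *\<^sub>v (Z x *\<^sub>v unit_vec n 0)))"

definition kdv_flow_solution :: "nat \<Rightarrow> nat \<Rightarrow> (real \<Rightarrow> real \<Rightarrow> real mat) \<Rightarrow> bool" where
  "kdv_flow_solution n j u \<longleftrightarrow>
     smooth_mat n (\<lambda>(x, t). u x t) \<and>
     (\<forall>x t. u x t \<in> V n) \<and>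
     (\<forall>t. \<exists>Z. is_Z0 n j (\<lambda>x. u x t) Z \<and>
        (\<forall>x. mat_deriv (\<lambda>s. u x s) t = conn (\<lambda>y. b_mat n + u y t) Z x))"

end

theory Submission
  imports Defs "HOL-Analysis.Henstock_Kurzweil_Integration"
begin

text \<open>
  The matrix \<open>W = g\<^sup>-\<^sup>1 g\<^sub>t\<close> satisfies the zero curvature equation \<open>W\<^sub>x + [b + u, W] = u\<^sub>t\<close>, by
  cross-differentiation of \<open>g\<^sub>x = g (b + u)\<close> and \<open>g\<^sub>t = g W\<close>. The flow says that \<open>W\<close> and \<open>Z\<^bsub>j,0\<^esub>(u)\<close> have
  the same first column. Since \<open>[\<partial>\<^sub>x + b + u, B] \<in> V\<^sub>n\<close> determines \<open>B\<close> by its first column, and holds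
  for both, they coincide.
\<close>

section \<open>Smooth functions\<close>

text \<open>A class above 0 records differentiability but not continuity. Differentiability gives
  continuity in the base case, and the induction then passes through the partial
  derivatives.\<close>

lemma class_C_Suc_imp: "class_C (Suc k) f \<Longrightarrow> class_C k f"
proof (induction k arbitrary: f)
  case 0
  then show ?case
    by (auto intro!: differentiable_imp_continuous_on simp: differentiable_on_def
        differentiable_at_withinI)
next
  case (Suc k)
  from Suc.prems have "\<forall>p. f differentiable (at p)"
    and "\<forall>e\<in>Basis. class_C (Suc k) (\<lambda>p. frechet_derivative f (at p) e)"
    using class_C.simps(2) by blast+
  then show ?case using Suc.IH by simp
qed

lemma class_C_const: "class_C k (\<lambda>p. c)"
  by (induction k arbitrary: c) (auto simp: frechet_derivative_const)

lemma class_C_add: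
  "class_C k f \<Longrightarrow> class_C k g \<Longrightarrow> class_C k (\<lambda>p. f p + g p)"
proof (induction k arbitrary: f g)
  case 0
  then show ?case by (auto intro: continuous_on_add)
next
  case (Suc k)
  have D: "f differentiable (at p)" "g differentiable (at p)" for p
    using Suc.prems by auto
  have fd: "frechet_derivative (\<lambda>p. f p + g p) (at p)
      = (\<lambda>e. frechet_derivative f (at p) e + frechet_derivative g (at p) e)" for p
    by (rule frechet_derivative_at[symmetric], rule has_derivative_add)
       (use D frechet_derivative_works in blast)+
  have "class_C k (\<lambda>p. frechet_derivative (\<lambda>p. f p + g p) (at p) e)" if "e \<in> Basis" for e
    unfolding fd using Suc.prems that by (intro Suc.IH) auto
  with D show ?case by auto
qed

lemma class_C_mult:
  "class_C k f \<Longrightarrow> class_C k g \<Longrightarrow> class_C k (\<lambda>p. f p * g p)"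
proof (induction k arbitrary: f g)
  case 0
  then show ?case by (auto intro: continuous_on_mult)
next
  case (Suc k)
  have D: "f differentiable (at p)" "g differentiable (at p)" for p
    using Suc.prems by auto
  have fd: "frechet_derivative (\<lambda>p. f p * g p) (at p)
      = (\<lambda>e. f p * frechet_derivative g (at p) e + frechet_derivative f (at p) e * g p)" for p
    by (rule frechet_derivative_at[symmetric], rule has_derivative_mult)
       (use D frechet_derivative_works in blast)+
  \<comment> \<open>The product rule leaves undifferentiated factors. They are known one class
    higher and must be lowered to class \<open>k\<close> for the induction hypothesis.\<close>
  have C: "class_C k f" "class_C k g"
    using Suc.prems class_C_Suc_imp by blast+
  have "class_C k (\<lambda>p. frechet_derivative (\<lambda>p. f p * g p) (at p) e)" if "e \<in> Basis" for e
    unfolding fd using Suc.prems that C by (intro class_C_add Suc.IH) auto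
  with D show ?case by auto
qed

lemma smooth_const: "smooth (\<lambda>p. c)"
  by (simp add: smooth_def class_C_const)

lemma smooth_add: "smooth f \<Longrightarrow> smooth g \<Longrightarrow> smooth (\<lambda>p. f p + g p)"
  by (simp add: smooth_def class_C_add)

lemma smooth_mult: "smooth f \<Longrightarrow> smooth g \<Longrightarrow> smooth (\<lambda>p. f p * g p)"
  by (simp add: smooth_def class_C_mult)

lemma smooth_diff: "smooth f \<Longrightarrow> smooth g \<Longrightarrow> smooth (\<lambda>p. f p - g p)"
  using smooth_add[OF _ smooth_mult[OF smooth_const[of "-1"]], of f g] by simp

text \<open>A sum over an infinite set is 0 by convention, hence constant; the induction rule treats
  this case along with the finite ones.\<close>

lemma smooth_sum: "(\<And>i. i \<in> I \<Longrightarrow> smooth (f i)) \<Longrightarrow> smooth (\<lambda>p. \<Sum>i\<in>I. f i p)"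
  by (induction I rule: infinite_finite_induct) (auto intro: smooth_const smooth_add)

lemma smooth_prod: "(\<And>i. i \<in> I \<Longrightarrow> smooth (f i)) \<Longrightarrow> smooth (\<lambda>p. \<Prod>i\<in>I. f i p)"
  by (induction I rule: infinite_finite_induct) (auto intro: smooth_const smooth_mult)

lemma smooth_imp_differentiable: "smooth f \<Longrightarrow> f differentiable (at p)"
  unfolding smooth_def by (metis class_C.simps(2))

lemma smooth_imp_continuous: "smooth f \<Longrightarrow> continuous_on UNIV f"
  unfolding smooth_def by (metis class_C.simps(1))

lemma smooth_frechet_derivative:
  "smooth f \<Longrightarrow> e \<in> Basis \<Longrightarrow> smooth (\<lambda>p. frechet_derivative f (at p) e)"
  unfolding smooth_def by (metis class_C.simps(2))

section \<open>Partial derivatives in the plane\<close>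

context
  fixes f :: "real \<Rightarrow> real \<Rightarrow> real"
  assumes smooth_f: "smooth (\<lambda>(x, t). f x t)"
begin

text \<open>Chain rule along the horizontal line sending \<open>s\<close> to \<open>(s, t)\<close>.
  It ties the one-variable derivatives of the moving frame to the Frechet derivatives in which
  smoothness is phrased.\<close>

lemma has_partial_frechet_fst:
  "((\<lambda>s. f s t) has_real_derivative frechet_derivative (\<lambda>(x, t). f x t) (at (x, t)) (1, 0)) (at x)"
proof -
  let ?D = "frechet_derivative (\<lambda>(x, t). f x t) (at (x, t))"
  have D: "((\<lambda>(x, t). f x t) has_derivative ?D) (at (x, t))"
    using smooth_imp_differentiable[OF smooth_f] frechet_derivative_works by blast
  have "((\<lambda>s. (s, t)) has_derivative (\<lambda>h. (h, 0))) (at x)"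
    by (auto intro!: derivative_eq_intros)
  from diff_chain_at[OF this D]
  have "((\<lambda>s. f s t) has_derivative (\<lambda>h. ?D (h, 0))) (at x)"
    by (simp add: o_def)
  \<comment> \<open>A linear map on the reals is multiplication by its value at 1, which is the form
    required of a field derivative.\<close>
  moreover have "(\<lambda>h. ?D (h, 0)) = (*) (?D (1, 0))"
  proof
    fix h
    show "?D (h, 0) = ?D (1, 0) * h"
      using linear_scale[OF has_derivative_linear[OF D], of h "(1, 0)"] by simp
  qed
  ultimately show ?thesis by (simp only: has_field_derivative_def)
qed

lemma has_partial_frechet_snd:
  "((\<lambda>s. f x s) has_real_derivative frechet_derivative (\<lambda>(x, t). f x t) (at (x, t)) (0, 1)) (at t)"
proof -
  let ?D = "frechet_derivative (\<lambda>(x, t). f x t) (at (x, t))"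
  have D: "((\<lambda>(x, t). f x t) has_derivative ?D) (at (x, t))"
    using smooth_imp_differentiable[OF smooth_f] frechet_derivative_works by blast
  have "((\<lambda>s. (x, s)) has_derivative (\<lambda>h. (0, h))) (at t)"
    by (auto intro!: derivative_eq_intros)
  from diff_chain_at[OF this D]
  have "((\<lambda>s. f x s) has_derivative (\<lambda>h. ?D (0, h))) (at t)"
    by (simp add: o_def)
  moreover have "(\<lambda>h. ?D (0, h)) = (*) (?D (0, 1))"
  proof
    fix h
    show "?D (0, h) = ?D (0, 1) * h"
      using linear_scale[OF has_derivative_linear[OF D], of h "(0, 1)"] by simp
  qed
  ultimately show ?thesis by (simp only: has_field_derivative_def)
qed

text \<open>\<open>deriv\<close> is a choice operator and is informative only where a derivative
  exists; the Frechet derivative provides that existence.\<close>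

lemma smooth_has_partial_fst:
  "((\<lambda>s. f s t) has_real_derivative deriv (\<lambda>s. f s t) x) (at x)"
  using has_partial_frechet_fst DERIV_imp_deriv by metis

lemma smooth_has_partial_snd:
  "((\<lambda>s. f x s) has_real_derivative deriv (\<lambda>s. f x s) t) (at t)"
  using has_partial_frechet_snd DERIV_imp_deriv by metis

text \<open>The partial derivative is the Frechet derivative in the basis direction
  \<open>(1, 0)\<close>, and such directional derivatives stay smooth by the recursive form of
  \<open>class_C\<close>.\<close>

lemma smooth_partial_fst: "smooth (\<lambda>(x, t). deriv (\<lambda>s. f s t) x)"
proof -
  have "(\<lambda>(x, t). deriv (\<lambda>s. f s t) x) = (\<lambda>p. frechet_derivative (\<lambda>(x, t). f x t) (at p) (1, 0))"
    by (auto intro!: ext DERIV_imp_deriv has_partial_frechet_fst)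
  then show ?thesis
    using smooth_frechet_derivative[OF smooth_f] by (simp add: Basis_prod_def)
qed

lemma smooth_partial_snd: "smooth (\<lambda>(x, t). deriv (\<lambda>s. f x s) t)"
proof -
  have "(\<lambda>(x, t). deriv (\<lambda>s. f x s) t) = (\<lambda>p. frechet_derivative (\<lambda>(x, t). f x t) (at p) (0, 1))"
    by (auto intro!: ext DERIV_imp_deriv has_partial_frechet_snd)
  then show ?thesis
    using smooth_frechet_derivative[OF smooth_f] by (simp add: Basis_prod_def)
qed

end

text \<open>
  Differentiate \<open>f x t = f a t + \<integral>\<^sub>a\<^sup>x f\<^sub>x s t ds\<close> first in \<open>t\<close>, under the integral, and then in \<open>x\<close>.
\<close>

lemma mixed_partials_commute:
  fixes f :: "real \<Rightarrow> real \<Rightarrow> real"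
  assumes f: "smooth (\<lambda>(x, t). f x t)"
  shows "deriv (\<lambda>y. deriv (\<lambda>s. f y s) t) x = deriv (\<lambda>s. deriv (\<lambda>y. f y s) x) t"
proof -
  define fx where "fx x t = deriv (\<lambda>y. f y t) x" for x t
  define fxt where "fxt x t = deriv (\<lambda>s. fx x s) t" for x t
  have fx: "smooth (\<lambda>(x, t). fx x t)"
    unfolding fx_def by (rule smooth_partial_fst[OF f])
  have fxt: "smooth (\<lambda>(x, t). fxt x t)"
    unfolding fxt_def by (rule smooth_partial_snd[OF fx])
  \<comment> \<open>Any base point below \<open>x\<close> would do: \<open>x\<close> must be
    interior to \<open>{a..x+1}\<close>, and \<open>a \<le> y\<close> must hold for all
    \<open>y\<close> near \<open>x\<close>.\<close>
  define a where "a = x - 1"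
  have cont: "continuous_on S (\<lambda>s. h s t)"
    if "smooth (\<lambda>(x, t). h x t)" for h :: "real \<Rightarrow> real \<Rightarrow> real" and S t
  proof -
    have "continuous_on S (\<lambda>s. case (s, t) of (x, t) \<Rightarrow> h x t)"
      by (rule continuous_on_compose2[OF smooth_imp_continuous[OF that]])
         (auto intro!: continuous_intros)
    then show ?thesis by simp
  qed
  have ftc: "integral {a..y} (\<lambda>s. fx s t) = f y t - f a t" if "a \<le> y" for y t
    using that smooth_has_partial_fst[OF f]
    by (intro integral_unique fundamental_theorem_of_calculus)
       (auto simp: fx_def has_real_derivative_iff_has_vector_derivative[symmetric]
         intro: has_field_derivative_at_within)
  have ft: "deriv (\<lambda>s. f y s) t = deriv (\<lambda>s. f a s) t + integral {a..y} (\<lambda>s. fxt s t)"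
    if "a \<le> y" for y
  proof -
    \<comment> \<open>The Leibniz rule takes the parameter \<open>t\<close> as first variable, so
      the coordinates are swapped.\<close>
    have "continuous_on UNIV (\<lambda>(t, x). fxt x t)"
      using continuous_on_compose2[OF smooth_imp_continuous[OF fxt] continuous_on_swap, of UNIV]
      by (simp add: split_beta prod.swap_def)
    then have "((\<lambda>t. integral (cbox a y) (\<lambda>s. fx s t)) has_real_derivative
        integral (cbox a y) (\<lambda>s. fxt s t)) (at t within UNIV)"
      by (intro leibniz_rule_field_derivative)
         (auto simp: fxt_def intro!: smooth_has_partial_snd[OF fx] integrable_continuous_real
           cont[OF fx] elim: continuous_on_subset)
    \<comment> \<open>By \<open>ftc\<close> the bracket is the integral just differentiated; the
      whole is \<open>f y t\<close>.\<close>
    then have "((\<lambda>t. f a t + (f y t - f a t)) has_real_derivative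
        deriv (\<lambda>s. f a s) t + integral {a..y} (\<lambda>s. fxt s t)) (at t)"
      by (intro DERIV_add smooth_has_partial_snd[OF f]) (simp add: ftc[OF that])
    then show ?thesis by (simp add: DERIV_imp_deriv)
  qed
  have "((\<lambda>y. integral {a..y} (\<lambda>s. fxt s t)) has_real_derivative fxt x t) (at x within {a..x+1})"
    by (rule integral_has_real_derivative) (auto simp: a_def intro!: cont[OF fxt])
  moreover have "at x within {a..x+1} = at x"
    by (rule at_within_interior) (auto simp: a_def)
  ultimately have "((\<lambda>y. deriv (\<lambda>s. f a s) t + integral {a..y} (\<lambda>s. fxt s t))
      has_real_derivative fxt x t) (at x)"
    by (auto intro!: derivative_eq_intros)
  \<comment> \<open>The formula \<open>ft\<close> holds only for \<open>y\<close> at or above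
    \<open>a\<close>, so its derivative in \<open>y\<close> is transferred through a neighbourhood
    of \<open>x\<close>.\<close>
  moreover have "eventually (\<lambda>y. y \<in> {a<..}) (nhds x)"
    by (rule eventually_nhds_in_open) (auto simp: a_def)
  then have "eventually (\<lambda>y. deriv (\<lambda>s. f y s) t
      = deriv (\<lambda>s. f a s) t + integral {a..y} (\<lambda>s. fxt s t)) (nhds x)"
    by eventually_elim (auto intro: ft)
  ultimately have "((\<lambda>y. deriv (\<lambda>s. f y s) t) has_real_derivative fxt x t) (at x)"
    by (simp cong: DERIV_cong_ev)
  then show ?thesis by (simp add: DERIV_imp_deriv fxt_def fx_def)
qed

section \<open>Smooth matrix functions\<close>

lemma smooth_matD:
  assumes "smooth_mat n A"
  shows "A p \<in> carrier_mat n n" and "i < n \<Longrightarrow> k < n \<Longrightarrow> smooth (\<lambda>p. A p $$ (i, k))"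
  using assms by (auto simp: smooth_mat_def)

lemma index_mult_mat_sum:
  "A \<in> carrier_mat n n \<Longrightarrow> B \<in> carrier_mat n n \<Longrightarrow> i < n \<Longrightarrow> k < n \<Longrightarrow>
    (A * B) $$ (i, k) = (\<Sum>l<n. A $$ (i, l) * B $$ (l, k))"
  by (auto simp: scalar_prod_def atLeast0LessThan)

lemma smooth_mat_mult:
  assumes "smooth_mat n A" and "smooth_mat n B"
  shows "smooth_mat n (\<lambda>p. A p * B p)"
proof -
  note AB = smooth_matD[OF assms(1)] smooth_matD[OF assms(2)]
  have "smooth (\<lambda>p. (A p * B p) $$ (i, k))" if "i < n" "k < n" for i k
    unfolding index_mult_mat_sum[OF AB(1,3) that]
    using AB that by (auto intro!: smooth_sum smooth_mult)
  then show ?thesis unfolding smooth_mat_def using mult_carrier_mat[OF AB(1,3)] by blast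
qed

text \<open>By the Leibniz expansion, the determinant is a polynomial in the entries.\<close>

lemma smooth_det:
  assumes "smooth_mat n A"
  shows "smooth (\<lambda>p. det (A p))"
  unfolding det_def'[OF smooth_matD(1)[OF assms]]
  using permutes_in_image
  by (fastforce intro!: smooth_sum smooth_mult smooth_const smooth_prod smooth_matD(2)[OF assms])

text \<open>The frame has determinant 1, so its adjugate is its inverse. Its entries are signed
  minors, hence the inverse is smooth without any division.\<close>

lemma smooth_adj_mat:
  assumes "smooth_mat n A"
  shows "smooth_mat n (\<lambda>p. adj_mat (A p))"
proof -
  note A = smooth_matD[OF assms]
  have dim [simp]: "dim_row (A p) = n" "dim_col (A p) = n" for p
    using A(1)[of p] by auto
  have del: "smooth_mat (n - 1) (\<lambda>p. mat_delete (A p) k i)" if "i < n" "k < n" for i k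
    using that by (auto simp: smooth_mat_def mat_delete_def intro!: A(2))
  have "smooth (\<lambda>p. adj_mat (A p) $$ (i, k))" if "i < n" "k < n" for i k
    using that smooth_det[OF del[OF that]]
    by (simp add: adj_mat_def cofactor_def smooth_mult smooth_const)
  then show ?thesis using adj_mat(1)[OF A(1)] by (simp add: smooth_mat_def)
qed

lemma mat_deriv_carrier: "A x \<in> carrier_mat n n \<Longrightarrow> mat_deriv A x \<in> carrier_mat n n"
  by (auto simp: mat_deriv_def)

lemma index_mat_deriv:
  "A x \<in> carrier_mat n n \<Longrightarrow> i < n \<Longrightarrow> k < n \<Longrightarrow>
    mat_deriv A x $$ (i, k) = deriv (\<lambda>s. A s $$ (i, k)) x"
  by (auto simp: mat_deriv_def)

text \<open>Differentiability of the entries is assumed explicitly because \<open>mat_deriv\<close>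
  is total and obeys no product rule where a derivative is missing.\<close>

lemma mat_deriv_mult:
  assumes A: "\<And>s. A s \<in> carrier_mat n n" and B: "\<And>s. B s \<in> carrier_mat n n"
    and dA: "\<And>i k. i < n \<Longrightarrow> k < n \<Longrightarrow>
      ((\<lambda>s. A s $$ (i, k)) has_real_derivative deriv (\<lambda>s. A s $$ (i, k)) x) (at x)"
    and dB: "\<And>i k. i < n \<Longrightarrow> k < n \<Longrightarrow>
      ((\<lambda>s. B s $$ (i, k)) has_real_derivative deriv (\<lambda>s. B s $$ (i, k)) x) (at x)"
  shows "mat_deriv (\<lambda>s. A s * B s) x = mat_deriv A x * B x + A x * mat_deriv B x"
proof (rule eq_matI)
  have dims [simp]: "dim_row (A s) = n" "dim_col (A s) = n" "dim_row (B s) = n" "dim_col (B s) = n"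
    for s using A[of s] B[of s] by auto
  fix i k
  assume "i < dim_row (mat_deriv A x * B x + A x * mat_deriv B x)"
    and "k < dim_col (mat_deriv A x * B x + A x * mat_deriv B x)"
  then have ik: "i < n" "k < n" by (auto simp: mat_deriv_def)
  have "((\<lambda>s. \<Sum>l<n. A s $$ (i, l) * B s $$ (l, k)) has_real_derivative
      (\<Sum>l<n. deriv (\<lambda>s. A s $$ (i, l)) x * B x $$ (l, k)
        + A x $$ (i, l) * deriv (\<lambda>s. B s $$ (l, k)) x)) (at x)"
    using ik by (intro DERIV_sum DERIV_mult[OF dA dB, THEN DERIV_cong]) auto
  then have "mat_deriv (\<lambda>s. A s * B s) x $$ (i, k)
      = (\<Sum>l<n. deriv (\<lambda>s. A s $$ (i, l)) x * B x $$ (l, k)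
        + A x $$ (i, l) * deriv (\<lambda>s. B s $$ (l, k)) x)"
    unfolding index_mat_deriv[of "\<lambda>s. A s * B s", OF mult_carrier_mat[OF A B] ik]
      index_mult_mat_sum[OF A B ik]
    by (rule DERIV_imp_deriv)
  also have "\<dots> = (mat_deriv A x * B x) $$ (i, k) + (A x * mat_deriv B x) $$ (i, k)"
    unfolding index_mult_mat_sum[OF mat_deriv_carrier[of A, OF A] B ik]
      index_mult_mat_sum[OF A mat_deriv_carrier[of B, OF B] ik] sum.distrib[symmetric]
    using ik by (simp add: index_mat_deriv[of A, OF A] index_mat_deriv[of B, OF B])
  also have "\<dots> = (mat_deriv A x * B x + A x * mat_deriv B x) $$ (i, k)"
    using ik by (simp add: mat_deriv_def)
  finally show "mat_deriv (\<lambda>s. A s * B s) x $$ (i, k)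
      = (mat_deriv A x * B x + A x * mat_deriv B x) $$ (i, k)" .
qed (auto simp: mat_deriv_def A[THEN carrier_matD(1)] A[THEN carrier_matD(2)]
  B[THEN carrier_matD(1)] B[THEN carrier_matD(2)])

section \<open>Matrix functions smooth jointly in x and t\<close>

context
  fixes n :: nat and A :: "real \<Rightarrow> real \<Rightarrow> real mat"
  assumes A: "smooth_mat n (\<lambda>(x, t). A x t)"
begin

lemma smooth_mat_plane_carrier: "A x t \<in> carrier_mat n n"
  using smooth_matD(1)[OF A, of "(x, t)"] by simp

lemma smooth_mat_plane_entry:
  "i < n \<Longrightarrow> k < n \<Longrightarrow> smooth (\<lambda>(x, t). A x t $$ (i, k))"
  using smooth_matD(2)[OF A, of i k] by (simp add: case_prod_unfold)

lemma smooth_mat_partial_fst: "smooth_mat n (\<lambda>(x, t). mat_deriv (\<lambda>s. A s t) x)"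
  using smooth_partial_fst[OF smooth_mat_plane_entry]
  by (auto simp: smooth_mat_def case_prod_unfold index_mat_deriv[OF smooth_mat_plane_carrier]
      intro: mat_deriv_carrier smooth_mat_plane_carrier)

lemma smooth_mat_partial_snd: "smooth_mat n (\<lambda>(x, t). mat_deriv (\<lambda>s. A x s) t)"
  using smooth_partial_snd[OF smooth_mat_plane_entry]
  by (auto simp: smooth_mat_def case_prod_unfold index_mat_deriv[OF smooth_mat_plane_carrier]
      intro: mat_deriv_carrier smooth_mat_plane_carrier)

lemma mat_deriv_mixed_partials_commute:
  "mat_deriv (\<lambda>y. mat_deriv (\<lambda>s. A y s) t) x = mat_deriv (\<lambda>s. mat_deriv (\<lambda>y. A y s) x) t"
  using smooth_mat_plane_carrier
  by (intro eq_matI)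
     (auto simp: index_mat_deriv[where n = n] mat_deriv_carrier mixed_partials_commute
       smooth_mat_plane_entry carrier_matD[OF mat_deriv_carrier[where n = n]])

end

lemma mat_deriv_mult_fst:
  fixes A B :: "real \<Rightarrow> real \<Rightarrow> real mat"
  assumes A: "smooth_mat n (\<lambda>(x, t). A x t)" and B: "smooth_mat n (\<lambda>(x, t). B x t)"
  shows "mat_deriv (\<lambda>s. A s t * B s t) x
    = mat_deriv (\<lambda>s. A s t) x * B x t + A x t * mat_deriv (\<lambda>s. B s t) x"
  by (rule mat_deriv_mult)
     (auto intro!: smooth_mat_plane_carrier[OF A] smooth_mat_plane_carrier[OF B]
       smooth_has_partial_fst smooth_mat_plane_entry[OF A] smooth_mat_plane_entry[OF B])

lemma mat_deriv_mult_snd: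
  fixes A B :: "real \<Rightarrow> real \<Rightarrow> real mat"
  assumes A: "smooth_mat n (\<lambda>(x, t). A x t)" and B: "smooth_mat n (\<lambda>(x, t). B x t)"
  shows "mat_deriv (\<lambda>s. A x s * B x s) t
    = mat_deriv (\<lambda>s. A x s) t * B x t + A x t * mat_deriv (\<lambda>s. B x s) t"
  by (rule mat_deriv_mult)
     (auto intro!: smooth_mat_plane_carrier[OF A] smooth_mat_plane_carrier[OF B]
       smooth_has_partial_snd smooth_mat_plane_entry[OF A] smooth_mat_plane_entry[OF B])

section \<open>The structure equation\<close>

lemma mat_mult_left_cancel:
  fixes A :: "real mat"
  assumes A: "A \<in> carrier_mat n n" "det A = 1" and XY: "X \<in> carrier_mat n n" "Y \<in> carrier_mat n n"
    and eq: "A * X = A * Y"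
  shows "X = Y"
proof -
  have inv: "adj_mat A * A = 1\<^sub>m n"
    using adj_mat(3)[OF A(1)] A(2) by (auto intro: eq_matI)
  have "adj_mat A * (A * X) = adj_mat A * (A * Y)"
    by (simp only: eq)
  then show ?thesis
    using assoc_mult_mat[OF adj_mat(1)[OF A(1)] A(1), of _ n] XY inv left_mult_one_mat by metis
qed

lemma mat_adj_cancel:
  fixes A :: "real mat"
  assumes A: "A \<in> carrier_mat n n" "det A = 1" and X: "X \<in> carrier_mat n n"
  shows "A * (adj_mat A * X) = X"
proof -
  have "A * adj_mat A = 1\<^sub>m n"
    using adj_mat(2)[OF A(1)] A(2) by (auto intro: eq_matI)
  then show ?thesis
    using assoc_mult_mat[OF A(1) adj_mat(1)[OF A(1)] X] X left_mult_one_mat by metis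
qed

text \<open>Both sides of \<open>(g W)\<^sub>x = (g A)\<^sub>t\<close>, where \<open>g W = g\<^sub>t\<close> and \<open>g A = g\<^sub>x\<close>, start with a factor \<open>g\<close>.\<close>

lemma zero_curvature:
  fixes g A :: "real \<Rightarrow> real \<Rightarrow> real mat"
  defines "W \<equiv> \<lambda>x t. adj_mat (g x t) * mat_deriv (\<lambda>s. g x s) t"
  assumes g: "smooth_mat n (\<lambda>(x, t). g x t)" and A: "smooth_mat n (\<lambda>(x, t). A x t)"
    and det: "\<And>x t. det (g x t) = 1"
    and gx: "\<And>x t. mat_deriv (\<lambda>s. g s t) x = g x t * A x t"
  shows "conn (\<lambda>y. A y t) (\<lambda>y. W y t) x = mat_deriv (\<lambda>s. A x s) t"
proof -
  have W: "smooth_mat n (\<lambda>(x, t). W x t)"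
    using smooth_mat_mult[OF smooth_adj_mat[OF g] smooth_mat_partial_snd[OF g]]
    by (simp add: W_def case_prod_unfold)
  note gC = smooth_mat_plane_carrier[OF g] and AC = smooth_mat_plane_carrier[OF A]
    and WC = smooth_mat_plane_carrier[OF W]
  note WxC = mat_deriv_carrier[where A = "\<lambda>y. W y t" and x = x, OF WC]
    and AtC = mat_deriv_carrier[where A = "\<lambda>s. A x s" and x = t, OF AC]
  \<comment> \<open>Since \<open>det\<close> is 1, the adjugate in \<open>W\<close> is the inverse
    of \<open>g\<close>, and multiplying by \<open>g\<close> undoes it.\<close>
  have gt: "mat_deriv (\<lambda>s. g x s) t = g x t * W x t" for x t
    unfolding W_def by (rule mat_adj_cancel[OF gC det mat_deriv_carrier[OF gC], symmetric])
  have "g x t * (A x t * W x t + mat_deriv (\<lambda>y. W y t) x)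
      = mat_deriv (\<lambda>y. g y t) x * W x t + g x t * mat_deriv (\<lambda>y. W y t) x"
    using mult_add_distrib_mat[OF gC mult_carrier_mat[OF AC WC] WxC] assoc_mult_mat[OF gC AC WC]
    by (simp add: gx)
  also have "\<dots> = mat_deriv (\<lambda>y. mat_deriv (\<lambda>s. g y s) t) x"
    unfolding gt by (rule mat_deriv_mult_fst[OF g W, symmetric])
  also have "\<dots> = mat_deriv (\<lambda>s. mat_deriv (\<lambda>y. g y s) x) t"
    by (rule mat_deriv_mixed_partials_commute[OF g])
  also have "\<dots> = mat_deriv (\<lambda>s. g x s) t * A x t + g x t * mat_deriv (\<lambda>s. A x s) t"
    unfolding gx by (rule mat_deriv_mult_snd[OF g A])
  also have "\<dots> = g x t * (W x t * A x t + mat_deriv (\<lambda>s. A x s) t)"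
    using mult_add_distrib_mat[OF gC mult_carrier_mat[OF WC AC] AtC] assoc_mult_mat[OF gC WC AC]
    by (simp add: gt)
  finally have eq: "A x t * W x t + mat_deriv (\<lambda>y. W y t) x
      = W x t * A x t + mat_deriv (\<lambda>s. A x s) t"
    by (rule mat_mult_left_cancel[OF gC det, rotated 2])
       (use AC WC AtC WxC in \<open>auto intro!: add_carrier_mat mult_carrier_mat\<close>)
  \<comment> \<open>Naming the two products keeps them opaque while the equation is rearranged entry
    by entry.\<close>
  define P Q where "P = A x t * W x t" and "Q = W x t * A x t"
  have PQ: "P \<in> carrier_mat n n" "Q \<in> carrier_mat n n"
    unfolding P_def Q_def by (auto intro: mult_carrier_mat AC WC)
  have "(P + mat_deriv (\<lambda>y. W y t) x) $$ (i, k) = (Q + mat_deriv (\<lambda>s. A x s) t) $$ (i, k)" for i k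
    using eq by (simp add: P_def Q_def)
  then have "P $$ (i, k) + mat_deriv (\<lambda>y. W y t) x $$ (i, k)
      = Q $$ (i, k) + mat_deriv (\<lambda>s. A x s) t $$ (i, k)" if "i < n" "k < n" for i k
    using that PQ WxC AtC index_add_mat(1) by (metis carrier_matD)
  then have "mat_deriv (\<lambda>y. W y t) x + (P - Q) = mat_deriv (\<lambda>s. A x s) t"
    using PQ WxC AtC by (intro eq_matI) (auto simp: algebra_simps)
  then show ?thesis by (simp add: conn_def commutator_def P_def Q_def)
qed

section \<open>Multiplication by b + v with v in V_n, and the recursion on columns\<close>

lemma b_mat_carrier: "b_mat n \<in> carrier_mat n n"
  by (simp add: b_mat_def)

lemma V_carrier: "v \<in> V n \<Longrightarrow> v \<in> carrier_mat n n"
  by (simp add: V_def)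

lemma V_index_eq_0: "v \<in> V n \<Longrightarrow> i < n \<Longrightarrow> Suc k < n \<Longrightarrow> v $$ (i, k) = 0"
proof -
  assume "v \<in> V n" "i < n" "Suc k < n"
  moreover from this have "k < n" "k \<noteq> n - 1" by auto
  ultimately show ?thesis unfolding V_def by blast
qed

lemma b_plus_V_carrier: "v \<in> V n \<Longrightarrow> b_mat n + v \<in> carrier_mat n n"
  by (simp add: V_def)

text \<open>Right multiplication by \<open>b_mat n\<close> moves column \<open>k + 1\<close> into
  column \<open>k\<close>, and \<open>v\<close> contributes to the last column only.\<close>

lemma mult_b_plus_V_col:
  assumes M: "M \<in> carrier_mat n n" and v: "v \<in> V n" and ik: "i < n" "Suc k < n"
  shows "(M * (b_mat n + v)) $$ (i, k) = M $$ (i, Suc k)"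
proof -
  have "(M * (b_mat n + v)) $$ (i, k) = (\<Sum>l<n. M $$ (i, l) * (b_mat n + v) $$ (l, k))"
    using index_mult_mat_sum[OF M b_plus_V_carrier[OF v]] ik by simp
  also have "\<dots> = (\<Sum>l<n. if l = Suc k then M $$ (i, l) else 0)"
    using V_carrier[OF v] V_index_eq_0[OF v] ik by (intro sum.cong) (auto simp: b_mat_def)
  finally show ?thesis using ik by simp
qed

text \<open>The last column of \<open>b_mat n\<close> is zero, so only \<open>v\<close> contributes;
  its corner entry vanishes, which ends the sum one index early.\<close>

lemma mult_b_plus_V_last_col:
  assumes M: "M \<in> carrier_mat n n" and v: "v \<in> V n" and i: "i < n"
  shows "(M * (b_mat n + v)) $$ (i, n - 1) = (\<Sum>l<n - 1. M $$ (i, l) * v $$ (l, n - 1))"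
proof -
  have "(M * (b_mat n + v)) $$ (i, n - 1) = (\<Sum>l<n. M $$ (i, l) * (b_mat n + v) $$ (l, n - 1))"
    using index_mult_mat_sum[OF M b_plus_V_carrier[OF v]] i by simp
  also have "\<dots> = (\<Sum>l<n. M $$ (i, l) * v $$ (l, n - 1))"
    using V_carrier[OF v] i by (intro sum.cong) (auto simp: b_mat_def)
  also have "\<dots> = (\<Sum>l<n - 1. M $$ (i, l) * v $$ (l, n - 1))"
    using v i by (intro sum.mono_neutral_right) (auto simp: V_def)
  finally show ?thesis .
qed

text \<open>
  The column \<open>k\<close> of the condition, for \<open>k < n - 1\<close>, expresses the column \<open>k + 1\<close> of \<open>B\<close> through the
  column \<open>k\<close>. The recursion uses only the values of \<open>deriv\<close>, so \<open>B\<close> need not be differentiable.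
\<close>

lemma conn_V_determined_by_first_col:
  assumes u: "\<And>x. u x \<in> V n"
    and B: "\<And>x. B x \<in> carrier_mat n n" "\<And>x. conn (\<lambda>s. b_mat n + u s) B x \<in> V n"
    and C: "\<And>x. C x \<in> carrier_mat n n" "\<And>x. conn (\<lambda>s. b_mat n + u s) C x \<in> V n"
    and first_col: "\<And>x i. i < n \<Longrightarrow> B x $$ (i, 0) = C x $$ (i, 0)"
  shows "B x = C x"
proof -
  have step: "M x $$ (i, Suc k) = deriv (\<lambda>s. M s $$ (i, k)) x
      + (\<Sum>l<n. (b_mat n + u x) $$ (i, l) * M x $$ (l, k))"
    if M: "\<And>x. M x \<in> carrier_mat n n" "\<And>x. conn (\<lambda>s. b_mat n + u s) M x \<in> V n"
      and ik: "i < n" "Suc k < n" for M x i k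
  proof -
    have k: "k < n" using ik by simp
    note uC = b_plus_V_carrier[OF u[of x]]
    \<comment> \<open>Column \<open>k\<close> lies to the left of the last column, where members of
      \<open>V n\<close> vanish. In the commutator, \<open>M * (b_mat n + u x)\<close> yields column
      \<open>k + 1\<close> of \<open>M\<close>, while the other product involves column
      \<open>k\<close> alone.\<close>
    have "0 = conn (\<lambda>s. b_mat n + u s) M x $$ (i, k)"
      using V_index_eq_0[OF M(2) ik] by simp
    also have "\<dots> = mat_deriv M x $$ (i, k)
        + (((b_mat n + u x) * M x) $$ (i, k) - (M x * (b_mat n + u x)) $$ (i, k))"
    proof -
      define P Q where "P = (b_mat n + u x) * M x" and "Q = M x * (b_mat n + u x)"
      have "P \<in> carrier_mat n n" "Q \<in> carrier_mat n n"
        unfolding P_def Q_def by (auto intro: mult_carrier_mat M uC)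
      then have "(mat_deriv M x + (P - Q)) $$ (i, k) = mat_deriv M x $$ (i, k) + (P $$ (i, k) - Q $$ (i, k))"
        using mat_deriv_carrier[OF M(1)] ik k by auto
      then show ?thesis by (simp add: conn_def commutator_def P_def Q_def)
    qed
    finally show ?thesis
      unfolding mult_b_plus_V_col[OF M(1) u ik] index_mult_mat_sum[OF uC M(1) ik(1) k]
        index_mat_deriv[OF M(1) ik(1) k]
      by simp
  qed
  have "B x $$ (i, k) = C x $$ (i, k)" if "i < n" "k < n" for x i k
    using that
  \<comment> \<open>The point \<open>x\<close> is generalised because the recursion differentiates
    column \<open>k\<close>, so equality is needed as functions of \<open>x\<close>;
    \<open>i\<close> is generalised because the product uses the whole column.\<close>
  proof (induction k arbitrary: x i)
    case 0
    then show ?case using first_col by simp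
  next
    case (Suc k)
    then have "(\<lambda>s. B s $$ (i, k)) = (\<lambda>s. C s $$ (i, k))"
      and "\<And>l. l < n \<Longrightarrow> B x $$ (l, k) = C x $$ (l, k)"
      by auto
    then show ?case
      using step[OF B Suc.prems, of x] step[OF C Suc.prems, of x] by simp
  qed
  then show ?thesis
    using B(1)[of x] C(1)[of x] by (intro eq_matI) auto
qed

section \<open>The moving frame\<close>

lemma frame_carrier: "frame n \<gamma> x \<in> carrier_mat n n"
  by (simp add: frame_def)

text \<open>Partial derivatives in x preserve joint smoothness in x and t. This is what later allows
  the frame to be differentiated in t as well.\<close>

lemma smooth_vec_iterated_deriv:
  fixes \<gamma> :: "real \<Rightarrow> real \<Rightarrow> real vec"
  assumes "smooth_vec n (\<lambda>(x, t). \<gamma> x t)"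
  shows "smooth_vec n (\<lambda>(x, t). (vec_deriv ^^ k) (\<lambda>y. \<gamma> y t) x)"
proof (induction k)
  case 0
  then show ?case using assms by simp
next
  case (Suc k)
  define D where "D x t = (vec_deriv ^^ k) (\<lambda>y. \<gamma> y t) x" for x t
  have D: "smooth_vec n (\<lambda>(x, t). D x t)"
    using Suc.IH by (simp add: D_def)
  have DC: "dim_vec (D x t) = n" for x t
    using D unfolding smooth_vec_def by (metis carrier_vecD case_prod_conv)
  have DS: "(vec_deriv ^^ Suc k) (\<lambda>y. \<gamma> y t) x = vec n (\<lambda>i. deriv (\<lambda>s. D s t $ i) x)" for x t
    by (simp add: vec_deriv_def D_def[symmetric] DC)
  have "smooth (\<lambda>(x, t). deriv (\<lambda>s. D s t $ i) x)" if "i < n" for i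
    by (rule smooth_partial_fst) (use D that in \<open>auto simp: smooth_vec_def case_prod_unfold\<close>)
  then show ?case
    unfolding DS by (auto simp: smooth_vec_def case_prod_unfold)
qed

lemma smooth_mat_frame:
  fixes \<gamma> :: "real \<Rightarrow> real \<Rightarrow> real vec"
  assumes "smooth_vec n (\<lambda>(x, t). \<gamma> x t)"
  shows "smooth_mat n (\<lambda>(x, t). frame n (\<lambda>y. \<gamma> y t) x)"
  using smooth_vec_iterated_deriv[OF assms]
  by (auto simp: smooth_mat_def frame_def smooth_vec_def case_prod_unfold)

lemma dim_iterated_vec_deriv: "dim_vec ((vec_deriv ^^ k) \<gamma> x) = dim_vec (\<gamma> x)"
  by (induction k arbitrary: x) (auto simp: vec_deriv_def)

text \<open>Differentiation turns each column of the frame into the next one, which is the shift by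
  \<open>b_mat n\<close>. The derivative of the last column is the n-th derivative of the curve,
  expanded by the curvature relation.\<close>

lemma frame_deriv:
  assumes \<gamma>: "\<And>x. \<gamma> x \<in> carrier_vec n" and u: "is_curvature n \<gamma> u"
  shows "mat_deriv (frame n \<gamma>) x = frame n \<gamma> x * (b_mat n + u x)"
proof (rule eq_matI)
  have uV: "u x \<in> V n" using u by (simp add: is_curvature_def)
  note uC = b_plus_V_carrier[OF uV]
  fix i k
  assume "i < dim_row (frame n \<gamma> x * (b_mat n + u x))" "k < dim_col (frame n \<gamma> x * (b_mat n + u x))"
  then have ik: "i < n" "k < n" using uC by (auto simp: frame_def)
  have L: "mat_deriv (frame n \<gamma>) x $$ (i, k) = (vec_deriv ^^ Suc k) \<gamma> x $ i"
    using ik carrier_vecD[OF \<gamma>]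
    by (simp add: index_mat_deriv[OF frame_carrier] frame_def vec_deriv_def dim_iterated_vec_deriv)
  show "mat_deriv (frame n \<gamma>) x $$ (i, k) = (frame n \<gamma> x * (b_mat n + u x)) $$ (i, k)"
  proof (cases "Suc k < n")
    case True
    then show ?thesis
      unfolding L mult_b_plus_V_col[OF frame_carrier uV ik(1) True] using ik by (simp add: frame_def)
  next
    case False
    then have k: "k = n - 1" "Suc k = n" using ik by auto
    show ?thesis
      unfolding L unfolding k mult_b_plus_V_last_col[OF frame_carrier uV ik(1)]
      using u ik by (auto simp: is_curvature_def frame_def mult.commute intro!: sum.cong)
  qed
next
  have "u x \<in> carrier_mat n n" using u by (auto simp: is_curvature_def V_def)
  then show "dim_row (mat_deriv (frame n \<gamma>) x) = dim_row (frame n \<gamma> x * (b_mat n + u x))"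
    and "dim_col (mat_deriv (frame n \<gamma>) x) = dim_col (frame n \<gamma> x * (b_mat n + u x))"
    by (auto simp: mat_deriv_def frame_def)
qed

section \<open>Uniqueness of the central affine curvature\<close>

lemma mat_add_left_cancel:
  fixes A :: "real mat"
  assumes "A \<in> carrier_mat n n" "X \<in> carrier_mat n n" "Y \<in> carrier_mat n n" "A + X = A + Y"
  shows "X = Y"
proof (rule eq_matI)
  fix i k
  assume "i < dim_row Y" "k < dim_col Y"
  moreover have "(A + X) $$ (i, k) = (A + Y) $$ (i, k)" using assms by simp
  ultimately show "X $$ (i, k) = Y $$ (i, k)" using assms(1-3) by auto
qed (use assms in auto)

text \<open>The frame is invertible, so its derivative determines \<open>b_mat n + u x\<close>. This
  identifies the curvature hidden in the existential of the curve flow with the one given in the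
  theorem.\<close>

lemma curvature_unique:
  assumes \<gamma>: "\<gamma> \<in> central_affine_curves n"
    and u: "is_curvature n \<gamma> u" and v: "is_curvature n \<gamma> v"
  shows "u = v"
proof
  fix x
  have \<gamma>C: "\<gamma> x \<in> carrier_vec n" for x
    using \<gamma> by (auto simp: central_affine_curves_def smooth_vec_def)
  have uv: "u x \<in> V n" "v x \<in> V n" using u v by (auto simp: is_curvature_def)
  have "frame n \<gamma> x * (b_mat n + u x) = frame n \<gamma> x * (b_mat n + v x)"
    using frame_deriv[OF \<gamma>C u] frame_deriv[OF \<gamma>C v] by metis
  moreover have "det (frame n \<gamma> x) = 1"
    using \<gamma> by (simp add: central_affine_curves_def)
  ultimately have "b_mat n + u x = b_mat n + v x"
    using mat_mult_left_cancel[OF frame_carrier _ uv[THEN b_plus_V_carrier]] by blast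
  then show "u x = v x"
    using mat_add_left_cancel[OF b_mat_carrier uv[THEN V_carrier]] by blast
qed

section \<open>From the curve flow to the KdV flow\<close>

theorem theorem3p2:
  fixes n j :: nat
    and \<gamma> :: "real \<Rightarrow> real \<Rightarrow> real vec"
    and u :: "real \<Rightarrow> real \<Rightarrow> real mat"
  assumes "n \<ge> 2" and "j \<ge> 1" and "j mod n \<noteq> 0"
    and "curve_flow_solution n j \<gamma>"
    and "\<And>t. is_curvature n (\<lambda>x. \<gamma> x t) (\<lambda>x. u x t)"
  shows "kdv_flow_solution n j u"
proof -
  have n: "n \<ge> 1" using assms(1) by simp
  have \<gamma>: "smooth_vec n (\<lambda>(x, t). \<gamma> x t)"
    and curve: "\<And>t. (\<lambda>x. \<gamma> x t) \<in> central_affine_curves n"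
    using assms(4) by (auto simp: curve_flow_solution_def)
  have \<gamma>C: "\<gamma> x t \<in> carrier_vec n" for x t
    using \<gamma> unfolding smooth_vec_def by (metis case_prod_conv)
  have uV: "u x t \<in> V n" for x t
    using assms(5) by (auto simp: is_curvature_def)
  define g where "g x t = frame n (\<lambda>y. \<gamma> y t) x" for x t
  define A where "A x t = b_mat n + u x t" for x t
  define W where "W x t = adj_mat (g x t) * mat_deriv (\<lambda>s. g x s) t" for x t
  have g: "smooth_mat n (\<lambda>(x, t). g x t)"
    unfolding g_def by (rule smooth_mat_frame[OF \<gamma>])
  have gC: "g x t \<in> carrier_mat n n" for x t
    unfolding g_def by (rule frame_carrier)
  have AC: "A x t \<in> carrier_mat n n" for x t
    unfolding A_def by (rule b_plus_V_carrier[OF uV])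
  have det: "det (g x t) = 1" for x t
    using curve[of t] by (simp add: g_def central_affine_curves_def)
  have adj: "adj_mat (g x t) * g x t = 1\<^sub>m n" for x t
    using adj_mat(3)[OF gC, of x t] det by (auto intro: eq_matI)
  have gx: "mat_deriv (\<lambda>y. g y t) x = g x t * A x t" for x t
    unfolding g_def A_def by (rule frame_deriv[OF \<gamma>C assms(5)])
  \<comment> \<open>\<open>is_curvature\<close> asserts no regularity of \<open>u\<close>. Solving
    the frame equation for \<open>A\<close> yields its joint smoothness, and then that of
    \<open>u\<close>.\<close>
  have "A x t = adj_mat (g x t) * mat_deriv (\<lambda>y. g y t) x" for x t
    unfolding gx using assoc_mult_mat[OF adj_mat(1)[OF gC] gC AC] adj left_mult_one_mat[OF AC] by metis
  then have A: "smooth_mat n (\<lambda>(x, t). A x t)"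
    using smooth_mat_mult[OF smooth_adj_mat[OF g] smooth_mat_partial_fst[OF g]]
    by (simp add: case_prod_unfold)
  have u_entry: "u x t $$ (i, k) = A x t $$ (i, k) - b_mat n $$ (i, k)" if "i < n" "k < n" for x t i k
    using that V_carrier[OF uV, of x t] by (auto simp: A_def)
  have u: "smooth_mat n (\<lambda>(x, t). u x t)"
    using V_carrier[OF uV] smooth_diff[OF smooth_mat_plane_entry[OF A] smooth_const]
    by (auto simp: smooth_mat_def case_prod_unfold u_entry)
  \<comment> \<open>The two differ by the constant matrix \<open>b_mat n\<close>.\<close>
  have ut: "mat_deriv (\<lambda>s. A x s) t = mat_deriv (\<lambda>s. u x s) t" for x t
  proof (rule eq_matI)
    fix i k
    assume "i < dim_row (mat_deriv (\<lambda>s. u x s) t)" "k < dim_col (mat_deriv (\<lambda>s. u x s) t)"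
    then have ik: "i < n" "k < n" using V_carrier[OF uV, of x t] by (auto simp: mat_deriv_def)
    have "((\<lambda>s. A x s $$ (i, k) - b_mat n $$ (i, k)) has_real_derivative
        deriv (\<lambda>s. A x s $$ (i, k)) t) (at t)"
      using smooth_has_partial_snd[OF smooth_mat_plane_entry[OF A ik]]
      by (auto intro!: derivative_eq_intros)
    then show "mat_deriv (\<lambda>s. A x s) t $$ (i, k) = mat_deriv (\<lambda>s. u x s) t $$ (i, k)"
      using ik by (simp add: index_mat_deriv[OF AC] index_mat_deriv[OF V_carrier[OF uV]] u_entry
          DERIV_imp_deriv)
  qed (use AC V_carrier[OF uV, of x t] in \<open>auto simp: mat_deriv_def A_def b_mat_def\<close>)
  have zero: "conn (\<lambda>y. A y t) (\<lambda>y. W y t) x = mat_deriv (\<lambda>s. u x s) t" for x t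
    unfolding W_def ut[symmetric] by (rule zero_curvature[OF g A det gx])
  \<comment> \<open>Entries of \<open>u\<close> outside the \<open>V n\<close> pattern vanish for
    all times, hence so do their t-derivatives. With \<open>zero\<close>, this puts the connection
    applied to \<open>W\<close> in \<open>V n\<close>.\<close>
  have utV: "mat_deriv (\<lambda>s. u x s) t \<in> V n" for x t
  proof -
    have "deriv (\<lambda>s. u x s $$ (i, k)) t = 0" if "i < n" "k < n" "\<not> (i < n - 1 \<and> k = n - 1)" for i k
    proof -
      have "(\<lambda>s. u x s $$ (i, k)) = (\<lambda>s. 0)" using uV that by (auto simp: V_def)
      then show ?thesis by simp
    qed
    then show ?thesis
      using mat_deriv_carrier[OF V_carrier[OF uV]]
      by (auto simp: V_def index_mat_deriv[OF V_carrier[OF uV]])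
  qed
  have WC: "W x t \<in> carrier_mat n n" for x t
    unfolding W_def by (rule mult_carrier_mat[OF adj_mat(1)[OF gC] mat_deriv_carrier[OF gC]])
  have "\<exists>Z. is_Z0 n j (\<lambda>x. u x t) Z \<and>
      (\<forall>x. mat_deriv (\<lambda>s. u x s) t = conn (\<lambda>y. b_mat n + u y t) Z x)" for t
  proof -
    obtain v Z where v: "is_curvature n (\<lambda>x. \<gamma> x t) v" and "is_Z0 n j v Z"
      and flow: "\<And>x. vec_deriv (\<lambda>s. \<gamma> x s) t = g x t *\<^sub>v (Z x *\<^sub>v unit_vec n 0)"
      using assms(4) unfolding curve_flow_solution_def g_def by metis
    then have Z: "is_Z0 n j (\<lambda>x. u x t) Z"
      using curvature_unique[OF curve v assms(5)] by simp
    \<comment> \<open>A matrix difference takes its dimensions from the second term, so the size of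
      \<open>Z\<close> is read off from \<zeta>.\<close>
    have ZC: "Z x \<in> carrier_mat n n" and ZV: "conn (\<lambda>s. b_mat n + u s t) Z x \<in> V n" for x
      using Z by (auto simp: is_Z0_def smooth_mat_def minus_carrier_mat)
    have first_col: "Z x $$ (i, 0) = W x t $$ (i, 0)" if "i < n" for x i
    proof -
      have gtC: "mat_deriv (\<lambda>s. g x s) t \<in> carrier_mat n n"
        by (rule mat_deriv_carrier[OF gC])
      have Z0: "Z x *\<^sub>v unit_vec n 0 = col (Z x) 0"
        using ZC[of x] n by (intro eq_vecI) auto
      \<comment> \<open>Column 0 of the frame is the curve itself, so column 0 of \<open>g\<close>'s
        t-derivative is the velocity prescribed by the flow. Multiplying by the inverse frame then
        compares \<open>W\<close> and \<open>Z\<close>.\<close>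
      have "col (mat_deriv (\<lambda>s. g x s) t) 0 = vec_deriv (\<lambda>s. \<gamma> x s) t"
        using n gtC carrier_vecD[OF \<gamma>C]
        by (intro eq_vecI)
          (auto simp: index_mat_deriv[where n = n, OF gC] g_def frame_def vec_deriv_def mat_deriv_def)
      also have "\<dots> = g x t *\<^sub>v col (Z x) 0"
        by (simp add: flow Z0)
      finally have "col (W x t) 0 = adj_mat (g x t) *\<^sub>v (g x t *\<^sub>v col (Z x) 0)"
        unfolding W_def using col_mult2[OF adj_mat(1)[OF gC] gtC, of 0] n by simp
      also have "\<dots> = col (Z x) 0"
        using assoc_mult_mat_vec[OF adj_mat(1)[OF gC] gC] adj one_mult_mat_vec ZC col_carrier_vec n
        by (metis One_nat_def Suc_le_lessD)
      finally have "col (W x t) 0 $ i = col (Z x) 0 $ i" by simp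
      then show ?thesis using that n ZC[of x] WC[of x t] by auto
    qed
    have "Z x = W x t" for x
      by (rule conn_V_determined_by_first_col[where u = "\<lambda>x. u x t", OF uV ZC ZV WC _ first_col])
         (use zero utV in \<open>simp_all add: A_def\<close>)
    then have "Z = (\<lambda>x. W x t)" by auto
    then show ?thesis using Z zero by (auto simp: A_def)
  qed
  then show ?thesis
    using u uV by (simp add: kdv_flow_solution_def)
qed

end
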